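(* Let $d\ge 1$ be an integer. Let $F$ be a nonnegative, non-decreasing function on $[0,1/2]$, which is normalised so that $$\int_0^{1/2}F(t)\,dt=\frac12 .$$ Let $w$ be the increasing convex continuous function on $[0,1/2]$ with $w(1/2)=1/2$, defined by $$w(x)=\int_0^xF(t)\,dt,\qquad 0\le x\le 1/2,$$ and extended to $[0,1]$ by $$w(x):=\int_0^x\widetilde F(t)\,dt,\qquad \widetilde F(t)=\begin{cases}F(t),&0\le t\le 1/2,\\ F(1-t),&1/2<t\le 1.\end{cases}$$ Then $w$ is an allowable weight function which satisfies $$w(\theta_1)+\cdots+w(\theta_{d+1})\le w(\theta_1+\cdots+\theta_{d+1})\le w(1)=1,\qquad \theta_j\ge 0,\quad \sum_{j=1}^{d+1}\theta_j\le 1.$$ Furthermore, $w$ is complementary, i.e., $$w(x)+w(1-x)=1,\qquad 0\le x\le 1,$$ and $$w(x)\le x,\quad 0\le x\le \tfrac12,\qquad w(x)\ge x,\quad \tfrac12\le x\le 1.$$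
   Context: A function $w:[0,1]\to[0,1]$ is an allowable weight function (for the dimension $d$) if: (i) $w$ is increasing on $[0,1]$; (ii) $w(0)=0$ and $w(1)=1$; (iii) $\sum_{i=1}^{d+1}w(\theta_i)\le 1$ for all $\theta_i\ge 0$, $1\le i\le d+1$, such that $\sum_{i=1}^{d+1}\theta_i=1$. *)

theory Defs
  imports "HOL-Analysis.Analysis"
begin

text \<open>
  ``Increasing'' is meant in the weak sense: a nonnegative non-decreasing density that vanishes
  near 0 yields a weight function that is constant near 0.
  Only the values of \<open>w\<close> on \<open>{0..1}\<close> matter.
\<close>

definition allowable_weight :: "nat \<Rightarrow> (real \<Rightarrow> real) \<Rightarrow> bool" where
  "allowable_weight d w \<longleftrightarrow>
     w \<in> {0..1} \<rightarrow> {0..1} \<and>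
     mono_on {0..1} w \<and>
     w 0 = 0 \<and> w 1 = 1 \<and>
     (\<forall>\<theta> :: nat \<Rightarrow> real.
        (\<forall>i\<in>{1..d+1}. 0 \<le> \<theta> i) \<and> (\<Sum>i=1..d+1. \<theta> i) = 1 \<longrightarrow>
        (\<Sum>i=1..d+1. w (\<theta> i)) \<le> 1)"

definition reflect_ext :: "(real \<Rightarrow> real) \<Rightarrow> real \<Rightarrow> real" where
  "reflect_ext F t = (if t \<le> 1/2 then F t else F (1 - t))"

end

theory Submission
  imports Defs
begin

text \<open>
  The proof rests on two properties of \<open>w\<close>: it is convex on \<open>{0..1/2}\<close> from \<open>w 0 = 0\<close> to
  \<open>w (1/2) = 1/2\<close>, because its density is non-decreasing, and it is complementary, because the
  density is extended by reflection about \<open>1/2\<close> and has total mass 1.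

  The chord from \<open>(0, 0)\<close> to \<open>(1/2, 1/2)\<close> lies above the graph of \<open>w\<close>, so \<open>w x \<le> x\<close> on the left
  half and, by complementarity, \<open>w x \<ge> x\<close> on the right half. The weight inequalities
  reduce to superadditivity, \<open>w x + w y \<le> w (x + y)\<close> for \<open>x, y \<ge> 0\<close> and \<open>x + y \<le> 1\<close>. With
  \<open>z = 1 - x - y\<close>, complementarity turns this into the symmetric inequality
  \<open>w x + w y + w z \<le> 1\<close> over \<open>x + y + z = 1\<close>. If all three numbers are at most \<open>1/2\<close>, then
  \<open>w t \<le> t\<close> gives the claim. If one of them exceeds \<open>1/2\<close>, the other two add up to less than
  \<open>1/2\<close>, and complementarity turns the symmetric inequality into superadditivity for those two,
  which convexity provides (\<open>complementary_convex_superadditive\<close>). Monotonicity of \<open>w\<close> on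
  \<open>{0..1}\<close> also comes from superadditivity, since the density is nonnegative and hence \<open>w \<ge> 0\<close>.
\<close>

text \<open>
  A primitive of a non-decreasing function lies above the line through each of its points whose
  slope is the value of the density there, since moving to the right of \<open>x\<close> one integrates values
  at least \<open>F x\<close>, and moving to the left, values at most \<open>F x\<close>.
\<close>

lemma integral_mono_on_supporting_line:
  fixes F :: "real \<Rightarrow> real"
  assumes F: "mono_on {a..b} F" and x: "x \<in> {a..b}" and y: "y \<in> {a..b}"
  shows "integral {a..x} F + F x * (y - x) \<le> integral {a..y} F"
proof -
  have int: "F integrable_on {u..v}" if "a \<le> u" "v \<le> b" for u v
  proof -
    have "F integrable_on {a..b}"
      using F by (rule integrable_on_mono_on)
    then show ?thesis
      by (rule integrable_on_subinterval) (use that in auto)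
  qed
  show ?thesis
  proof (cases "x \<le> y")
    case True
    have "integral {a..x} F + integral {x..y} F = integral {a..y} F"
      using x y True by (intro Henstock_Kurzweil_Integration.integral_combine int) auto
    moreover have "integral {x..y} (\<lambda>_. F x) \<le> integral {x..y} F"
      using x y True by (intro integral_le int integrable_const_ivl monotone_onD[OF F]) auto
    ultimately show ?thesis
      using True by (simp add: mult.commute)
  next
    case False
    have "integral {a..y} F + integral {y..x} F = integral {a..x} F"
      using x y False by (intro Henstock_Kurzweil_Integration.integral_combine int) auto
    moreover have "integral {y..x} F \<le> integral {y..x} (\<lambda>_. F x)"
      using x y False by (intro integral_le int integrable_const_ivl monotone_onD[OF F]) auto
    ultimately show ?thesis
      using False by (simp add: algebra_simps)
  qed
qed

lemma convex_on_if_supporting_lines: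
  fixes f s :: "real \<Rightarrow> real"
  assumes S: "convex S"
    and line: "\<And>x y. x \<in> S \<Longrightarrow> y \<in> S \<Longrightarrow> f x + s x * (y - x) \<le> f y"
  shows "convex_on S f"
proof (intro convex_onI S)
  fix t x y :: real
  assume t: "0 < t" "t < 1" and xy: "x \<in> S" "y \<in> S"
  define z where "z = (1 - t) *\<^sub>R x + t *\<^sub>R y"
  have z: "z \<in> S"
    unfolding z_def using S xy t by (intro convexD_alt) auto
  have "f z = (1 - t) * (f z + s z * (x - z)) + t * (f z + s z * (y - z))"
    unfolding z_def by (simp add: algebra_simps)
  also have "\<dots> \<le> (1 - t) * f x + t * f y"
    using t line[OF z xy(1)] line[OF z xy(2)] by (intro add_mono mult_left_mono) auto
  finally show "f ((1 - t) *\<^sub>R x + t *\<^sub>R y) \<le> (1 - t) * f x + t * f y"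
    unfolding z_def .
qed

text \<open>
  Half of the mass of the reflected density is already collected at \<open>1/2\<close>; what is added up to
  \<open>x\<close> is, after the substitution \<open>t \<mapsto> 1 - t\<close>, the mass of \<open>F\<close> on \<open>{1 - x..1/2}\<close>.
\<close>

lemma integral_reflect_ext:
  fixes F :: "real \<Rightarrow> real"
  assumes int: "F integrable_on {0..1/2}" and x: "1/2 \<le> x" "x \<le> 1"
  shows "integral {0..x} (reflect_ext F) = 2 * integral {0..1/2} F - integral {0..1 - x} F"
proof -
  have left: "(reflect_ext F has_integral integral {0..1/2} F) {0..1/2}"
    using integrable_integral[OF int]
    by (rule has_integral_eq[rotated]) (simp add: reflect_ext_def)
  have sub: "F integrable_on {1 - x..1/2}"
    using int by (rule integrable_on_subinterval) (use x in auto)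
  have "((\<lambda>t. F (1 - t)) has_integral integral {1 - x..1/2} F) {1/2..x}"
    using has_integral_affinity[of F "integral {1 - x..1/2} F" "1 - x" "1/2" "-1" 1]
      integrable_integral[OF sub] by (simp add: algebra_simps)
  then have right: "(reflect_ext F has_integral integral {1 - x..1/2} F) {1/2..x}"
  proof (rule has_integral_eq[rotated])
    show "F (1 - t) = reflect_ext F t" if "t \<in> {1/2..x}" for t
    proof (cases "t = 1/2")
      case True
      show ?thesis unfolding True by (simp add: reflect_ext_def)
    qed (use that in \<open>auto simp: reflect_ext_def\<close>)
  qed
  have "(reflect_ext F has_integral integral {0..1/2} F + integral {1 - x..1/2} F) {0..x}"
    using x by (intro has_integral_combine[OF _ _ left right]) auto
  moreover have "integral {0..1 - x} F + integral {1 - x..1/2} F = integral {0..1/2} F"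
    using x int by (intro Henstock_Kurzweil_Integration.integral_combine) auto
  ultimately show ?thesis
    by (simp add: integral_unique)
qed

lemma convex_on_superadditive:
  fixes f :: "real \<Rightarrow> real"
  assumes f: "convex_on {0..c} f" and f0: "f 0 \<le> 0"
    and xy: "0 \<le> x" "0 \<le> y" "x + y \<le> c"
  shows "f x + f y \<le> f (x + y)"
proof (cases "x + y = 0")
  case True
  with xy f0 show ?thesis
    by (simp add: add_nonneg_eq_0_iff)
next
  case False
  then have pos: "0 < x + y"
    using xy by linarith
  \<comment> \<open>Between \<open>0\<close> and \<open>x + y\<close>, a convex function with \<open>f 0 \<le> 0\<close> lies below the segment from the
    origin to \<open>(x + y, f (x + y))\<close>.\<close>
  have below: "f u \<le> u / (x + y) * f (x + y)" if u: "0 \<le> u" "u \<le> x + y" for u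
  proof -
    have "f ((1 - u / (x + y)) *\<^sub>R 0 + (u / (x + y)) *\<^sub>R (x + y))
        \<le> (1 - u / (x + y)) * f 0 + u / (x + y) * f (x + y)"
      using u pos xy by (intro convex_onD[OF f]) auto
    also have "(1 - u / (x + y)) * f 0 \<le> 0"
      using u pos f0 by (intro mult_nonneg_nonpos) auto
    finally show ?thesis
      using pos by simp
  qed
  have "f x + f y \<le> x / (x + y) * f (x + y) + y / (x + y) * f (x + y)"
    using xy by (intro add_mono below) auto
  also have "\<dots> = f (x + y)"
    using pos by (simp add: distrib_right[symmetric] add_divide_distrib[symmetric])
  finally show ?thesis .
qed

text \<open>
  Beyond \<open>1/2\<close> the function is concave, so convexity alone is of no use there; the symmetric
  form \<open>f x + f y + f z \<le> 1\<close> allows one to choose which two of the three points to treat by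
  convexity, namely two whose sum stays in the left half.
\<close>

lemma complementary_convex_superadditive:
  fixes f :: "real \<Rightarrow> real"
  assumes f: "convex_on {0..1/2} f" and f0: "f 0 \<le> 0"
    and below_id: "\<And>x. x \<in> {0..1/2} \<Longrightarrow> f x \<le> x"
    and compl: "\<And>x. x \<in> {0..1} \<Longrightarrow> f x + f (1 - x) = 1"
    and xy: "0 \<le> x" "0 \<le> y" "x + y \<le> 1"
  shows "f x + f y \<le> f (x + y)"
proof -
  have dominant: "f a + f b + f c \<le> 1"
    if "0 \<le> a" "0 \<le> b" "1/2 \<le> c" "a + b + c = 1" for a b c
  proof -
    have "f a + f b \<le> f (a + b)"
      using that by (intro convex_on_superadditive[OF f f0]) auto
    moreover have "a + b = 1 - c"
      using that by simp
    ultimately show ?thesis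
      using compl[of c] that by simp
  qed
  define z where "z = 1 - (x + y)"
  have z: "0 \<le> z" "x + y + z = 1"
    using xy by (auto simp: z_def)
  consider "1/2 \<le> x" | "1/2 \<le> y" | "1/2 \<le> z" | "x \<le> 1/2" "y \<le> 1/2" "z \<le> 1/2"
    by linarith
  then have "f x + f y + f z \<le> 1"
  proof cases
    case 1
    then show ?thesis using dominant[of y z x] xy z by simp
  next
    case 2
    then show ?thesis using dominant[of x z y] xy z by simp
  next
    case 3
    then show ?thesis using dominant[of x y z] xy z by simp
  next
    case 4
    then show ?thesis using below_id[of x] below_id[of y] below_id[of z] xy z by simp
  qed
  then show ?thesis
    using compl[of "x + y"] xy by (simp add: z_def)
qed

lemma superadditive_sum_le:
  fixes f :: "real \<Rightarrow> real"
  assumes super: "\<And>x y. 0 \<le> x \<Longrightarrow> 0 \<le> y \<Longrightarrow> x + y \<le> c \<Longrightarrow> f x + f y \<le> f (x + y)"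
    and f0: "0 \<le> f 0"
    and "finite A" "\<And>i. i \<in> A \<Longrightarrow> 0 \<le> g i" "sum g A \<le> c"
  shows "(\<Sum>i\<in>A. f (g i)) \<le> f (sum g A)"
  using assms(3-)
proof (induction A rule: finite_induct)
  case empty
  then show ?case using f0 by simp
next
  case (insert a A)
  have nonneg: "0 \<le> g a" "0 \<le> sum g A"
    using insert.prems by (auto intro: sum_nonneg)
  have "(\<Sum>i\<in>A. f (g i)) \<le> f (sum g A)"
    using insert.prems(2) insert.hyps nonneg by (intro insert.IH insert.prems(1)) auto
  then show ?case
    using super[of "g a" "sum g A"] insert nonneg by simp
qed

theorem proposition3:
  fixes d :: nat and F w :: "real \<Rightarrow> real"
  assumes "d \<ge> 1"
    and F_nonneg: "\<And>t. t \<in> {0..1/2} \<Longrightarrow> 0 \<le> F t"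
    and F_mono: "mono_on {0..1/2} F"
    and F_normalised: "integral {0..1/2} F = 1/2"
    and w_left: "\<And>x. x \<in> {0..1/2} \<Longrightarrow> w x = integral {0..x} F"
    and w_right: "\<And>x. x \<in> {1/2<..1} \<Longrightarrow> w x = integral {0..x} (reflect_ext F)"
  shows "mono_on {0..1/2} w \<and> convex_on {0..1/2} w \<and> continuous_on {0..1/2} w \<and> w (1/2) = 1/2 \<and>
    allowable_weight d w \<and>
    (\<forall>\<theta> :: nat \<Rightarrow> real.
           (\<forall>j\<in>{1..d+1}. 0 \<le> \<theta> j) \<and> (\<Sum>j=1..d+1. \<theta> j) \<le> 1 \<longrightarrow>
           (\<Sum>j=1..d+1. w (\<theta> j)) \<le> w (\<Sum>j=1..d+1. \<theta> j) \<and>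
           w (\<Sum>j=1..d+1. \<theta> j) \<le> w 1 \<and> w 1 = 1) \<and>
    (\<forall>x\<in>{0..1}. w x + w (1 - x) = 1) \<and>
    (\<forall>x\<in>{0..1/2}. w x \<le> x) \<and>
    (\<forall>x\<in>{1/2..1}. w x \<ge> x)"
proof -
  have int: "F integrable_on {0..1/2}"
    using F_mono by (rule integrable_on_mono_on)
  have w0: "w 0 = 0" and w_half: "w (1/2) = 1/2"
    using w_left F_normalised by auto
  have conv: "convex_on {0..1/2} w"
  proof (rule convex_on_if_supporting_lines)
    fix x y :: real
    assume "x \<in> {0..1/2}" "y \<in> {0..1/2}"
    then show "w x + F x * (y - x) \<le> w y"
      using integral_mono_on_supporting_line[OF F_mono] w_left by simp
  qed simp
  have cont: "continuous_on {0..1/2} w"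
    using indefinite_integral_continuous_1[OF int]
    by (rule continuous_on_eq) (simp add: w_left)
  have compl: "w x + w (1 - x) = 1" if "x \<in> {0..1}" for x
  proof -
    have right: "w u + w (1 - u) = 1" if "1/2 < u" "u \<le> 1" for u
      using integral_reflect_ext[OF int, of u] w_right[of u] w_left[of "1 - u"] F_normalised that
      by simp
    consider "x < 1/2" | "x = 1/2" | "1/2 < x"
      by linarith
    then show ?thesis
    proof cases
      case 2
      show ?thesis unfolding 2 using w_half by simp
    qed (use right[of x] right[of "1 - x"] that in auto)
  qed
  have nonneg_left: "0 \<le> w x" if "x \<in> {0..1/2}" for x
    using that unfolding w_left[OF that]
    by (intro integral_nonneg integrable_on_subinterval[OF int] F_nonneg) auto
  have below_id: "w x \<le> x" if "x \<in> {0..1/2}" for x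
  proof -
    have "w ((1 - 2 * x) *\<^sub>R 0 + (2 * x) *\<^sub>R (1/2)) \<le> (1 - 2 * x) * w 0 + 2 * x * w (1/2)"
      using that by (intro convex_onD[OF conv]) auto
    then show ?thesis
      by (simp add: w0 w_half)
  qed
  have above_id: "x \<le> w x" if "x \<in> {1/2..1}" for x
    using below_id[of "1 - x"] compl[of x] that by simp
  have nonneg: "0 \<le> w x" if "x \<in> {0..1}" for x
    using nonneg_left[of x] above_id[of x] that by (cases "x \<le> 1/2") auto
  have super: "w x + w y \<le> w (x + y)" if "0 \<le> x" "0 \<le> y" "x + y \<le> 1" for x y
    using that
    by (intro complementary_convex_superadditive[OF conv _ below_id compl]) (auto simp: w0)
  \<comment> \<open>Monotonicity on all of \<open>{0..1}\<close> is superadditivity applied to \<open>x\<close> and the increment \<open>y - x\<close>.\<close>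
  have mono: "mono_on {0..1} w"
  proof (rule monotone_onI)
    fix x y :: real
    assume "x \<in> {0..1}" "y \<in> {0..1}" "x \<le> y"
    then show "w x \<le> w y"
      using super[of x "y - x"] nonneg[of "y - x"] by simp
  qed
  have w1: "w 1 = 1"
    using compl[of 0] w0 by simp
  have w_le: "w x \<le> w 1" if "x \<in> {0..1}" for x
    using that by (intro monotone_onD[OF mono]) auto
  have sums: "(\<Sum>j=1..d+1. w (\<theta> j)) \<le> w (\<Sum>j=1..d+1. \<theta> j) \<and> w (\<Sum>j=1..d+1. \<theta> j) \<le> w 1"
    if "\<forall>j\<in>{1..d+1}. 0 \<le> \<theta> j" "(\<Sum>j=1..d+1. \<theta> j) \<le> 1" for \<theta> :: "nat \<Rightarrow> real"
    using that w0
    by (intro conjI superadditive_sum_le[OF super] w_le)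
      (auto intro!: sum_nonneg simp del: sum.cl_ivl_Suc)
  have "mono_on {0..1/2} w"
    using mono by (rule monotone_on_subset) auto
  moreover have "allowable_weight d w"
    unfolding allowable_weight_def
  proof (intro conjI allI impI mono w0 w1)
    show "w \<in> {0..1} \<rightarrow> {0..1}"
      using nonneg w_le w1 by auto
    show "(\<Sum>i=1..d+1. w (\<theta> i)) \<le> 1"
      if "(\<forall>i\<in>{1..d+1}. 0 \<le> \<theta> i) \<and> (\<Sum>i=1..d+1. \<theta> i) = 1" for \<theta> :: "nat \<Rightarrow> real"
      using sums[of \<theta>] that w1 by linarith
  qed
  ultimately show ?thesis
    using conv cont w_half sums w1 compl below_id above_id by blast
qed

end
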